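(* There exist constants $c>0$ and $n_0\in\mathbb{N}$ such that for every $n\ge n_0$ there is an $n$-player potential game in which every player has two actions and all utilities lie in $[0,1]$, together with an initial pure action profile, such that fictitious play started at that profile takes at least $2^{c\,2^n}$ iterations to reach an $\epsilon$-Nash equilibrium for $\epsilon=1/2^n$; i.e., for every $t\le 2^{c\,2^n}$ the profile $\boldsymbol{x}^{(t)}$ is not a $2^{-n}$-Nash equilibrium.
   Context: A finite $n$-player game with utilities $u_i$ is a potential game if there is $\Phi$ with $u_i(\boldsymbol{x}_i,\boldsymbol{x}_{-i})-u_i(\boldsymbol{x}_i',\boldsymbol{x}_{-i})=\Phi(\boldsymbol{x}_i,\boldsymbol{x}_{-i})-\Phi(\boldsymbol{x}_i',\boldsymbol{x}_{-i})$ for all players $i$ and strategies. A profile $\boldsymbol{x}$ is an $\epsilon$-Nash equilibrium if $u_i(\boldsymbol{x}_i',\boldsymbol{x}_{-i})\le u_i(\boldsymbol{x})+\epsilon$ for all $i$ and $\boldsymbol{x}_i'$. Fictitious play (simultaneous): $\boldsymbol{x}^{(1)}$ is a given pure profile; with $\boldsymbol{u}_i^{(t)}[a]=u_i(a,\boldsymbol{x}_{-i}^{(t)})$ for each action $a$ of player $i$, each player $i$ plays at round $t+1$ a pure action $\boldsymbol{x}_i^{(t+1)}\in\arg\max_{a}\sum_{\tau=1}^t\boldsymbol{u}_i^{(\tau)}[a]$, with ties broken by an arbitrary rule. *)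

theory Defs
  imports "HOL-Probability.Product_PMF" "HOL-Library.FuncSet"
begin

text \<open>
  The players of an \<open>n\<close>-player game are \<open>0, \<dots>, n - 1\<close>, and \<open>'a\<close> is the finite set of actions of
  each of them. Profiles, pure (entries in \<open>'a\<close>) as well as mixed (entries in \<open>'a pmf\<close>), are
  extensional functions, so that a payoff function cannot depend on anything beyond the \<open>n\<close>
  players.
\<close>

type_synonym 'a game = "nat \<Rightarrow> (nat \<Rightarrow> 'a) \<Rightarrow> real"

definition profiles :: "nat \<Rightarrow> (nat \<Rightarrow> 'b) set" where
  "profiles n = {..<n} \<rightarrow>\<^sub>E UNIV"

definition pure_profile :: "nat \<Rightarrow> (nat \<Rightarrow> 'a) \<Rightarrow> nat \<Rightarrow> 'a pmf" where
  "pure_profile n s = (\<lambda>i\<in>{..<n}. return_pmf (s i))"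

text \<open>The utility of player \<open>i\<close> under a mixed profile: the actions are drawn independently.\<close>

definition utility :: "nat \<Rightarrow> ('a::finite) game \<Rightarrow> nat \<Rightarrow> (nat \<Rightarrow> 'a pmf) \<Rightarrow> real" where
  "utility n u i x = measure_pmf.expectation (Pi_pmf {..<n} undefined x) (u i)"

definition potential_game :: "nat \<Rightarrow> ('a::finite) game \<Rightarrow> bool" where
  "potential_game n u \<longleftrightarrow>
     (\<exists>\<Phi> :: (nat \<Rightarrow> 'a pmf) \<Rightarrow> real. \<forall>i<n. \<forall>x\<in>profiles n. \<forall>p q.
        utility n u i (x(i := p)) - utility n u i (x(i := q)) = \<Phi> (x(i := p)) - \<Phi> (x(i := q)))"

definition nash_equilibrium ::
    "real \<Rightarrow> nat \<Rightarrow> ('a::finite) game \<Rightarrow> (nat \<Rightarrow> 'a pmf) \<Rightarrow> bool" where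
  "nash_equilibrium \<epsilon> n u x \<longleftrightarrow>
     (\<forall>i<n. \<forall>p. utility n u i (x(i := p)) \<le> utility n u i x + \<epsilon>)"

text \<open>
  \<open>fictitious_play n u s x\<close>: the sequence of pure profiles \<open>x 1, x 2, \<dots>\<close> is a run of simultaneous
  fictitious play from \<open>s\<close>; rounds are counted from 1 and \<open>x 0\<close> is irrelevant. Ties may be broken
  in any way, so there can be several runs from the same \<open>s\<close>.
\<close>

definition fictitious_play ::
    "nat \<Rightarrow> ('a::finite) game \<Rightarrow> (nat \<Rightarrow> 'a) \<Rightarrow> (nat \<Rightarrow> nat \<Rightarrow> 'a) \<Rightarrow> bool" where
  "fictitious_play n u s x \<longleftrightarrow>
     x 1 = s \<and> (\<forall>t\<ge>1. x t \<in> profiles n) \<and>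
     (\<forall>t\<ge>1. \<forall>i<n. is_arg_max (\<lambda>a. \<Sum>\<tau>=1..t. u i ((x \<tau>)(i := a))) (\<lambda>a. True) (x (t + 1) i))"

lemma utility_pure_profile:
  assumes "s \<in> profiles n"
  shows "utility n u i (pure_profile n s) = u i s"
proof -
  have "Pi_pmf {..<n} undefined (pure_profile n s) =
        Pi_pmf {..<n} undefined (\<lambda>j. return_pmf (s j))"
    by (rule Pi_pmf_cong) (auto simp: pure_profile_def)
  also have "\<dots> = return_pmf (\<lambda>j. if j \<in> {..<n} then s j else undefined)"
    by (rule Pi_pmf_return_pmf) simp
  also have "(\<lambda>j. if j \<in> {..<n} then s j else undefined) = s"
    using assms by (auto simp: profiles_def PiE_def extensional_def)
  finally show ?thesis by (simp add: utility_def)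
qed

lemma fictitious_play_exists:
  fixes u :: "('a::finite) game"
  assumes "s \<in> profiles n"
  shows "\<exists>x. fictitious_play n u s x"
proof -
  define next_profile :: "(nat \<Rightarrow> 'a) list \<Rightarrow> nat \<Rightarrow> 'a" where
    "next_profile h = (\<lambda>i\<in>{..<n}. SOME a.
       is_arg_max (\<lambda>a. \<Sum>y\<leftarrow>h. u i (y(i := a))) (\<lambda>a. True) a)" for h
  define H where "H = rec_nat [s] (\<lambda>_ h. h @ [next_profile h])"
  define x where "x t = last (H (t - 1))" for t
  have H0: "H 0 = [s]" and HS: "H (Suc t) = H t @ [next_profile (H t)]" for t
    by (simp_all add: H_def)
  have sum_H: "(\<Sum>y\<leftarrow>H t. f y) = (\<Sum>\<tau>=1..Suc t. f (x \<tau>))" for t and f :: "(nat \<Rightarrow> 'a) \<Rightarrow> real"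
  proof (induction t)
    case 0
    then show ?case by (simp add: H0 x_def)
  next
    case (Suc t)
    then show ?case by (simp add: HS x_def)
  qed
  have ex: "\<exists>a. is_arg_max f (\<lambda>a. True) a" for f :: "'a \<Rightarrow> real"
  proof -
    have "Max (range f) \<in> range f" by (rule Max_in) auto
    then obtain a where "f a = Max (range f)" by (metis imageE)
    then have "is_arg_max f (\<lambda>a. True) a" by (simp add: is_arg_max_linorder)
    then show ?thesis ..
  qed
  have "x t \<in> profiles n" for t
    using assms by (cases "t - 1") (auto simp: x_def H0 HS next_profile_def profiles_def)
  moreover have "is_arg_max (\<lambda>a. \<Sum>\<tau>=1..t. u i ((x \<tau>)(i := a))) (\<lambda>a. True) (x (t + 1) i)"
    if t: "t \<ge> 1" and i: "i < n" for t i
  proof -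
    obtain k where k: "t = Suc k" using t by (cases t) auto
    have "x (t + 1) = next_profile (H k)" by (simp add: x_def k HS)
    then show ?thesis
      using i someI_ex[OF ex] by (simp add: next_profile_def sum_H k)
  qed
  ultimately have "fictitious_play n u s x"
    by (simp add: fictitious_play_def x_def H0)
  then show ?thesis by blast
qed

end

theory Submission
  imports Defs
begin

text \<open>
  Let \<open>v 0, \<dots>, v N\<close> be an induced path in the \<open>n\<close>-cube, and let all players receive the same payoff,
  \<open>1 / 2 + k \<delta>\<close> at \<open>v k\<close> with \<open>\<delta> = 2 / 2 ^ n\<close>, and \<open>0\<close> off the path. Fictitious play follows the path
  whatever the ties, and each stage lasts at least \<open>2 ^ n / 4\<close> times as long as the one before, because
  the player about to move has been held in place during the previous stage by a
  payoff difference of at least \<open>1 / 2\<close> and is now drawn away by \<open>\<delta>\<close> only. Reaching the end takes about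
  \<open>2 ^ (n N)\<close> rounds, so an induced path of length \<open>N\<close> of order \<open>2 ^ n / n\<close> suffices. It is
  found as a shortest path in a set of vertices that thickens a Gray code on \<open>m\<close> coordinates by
  \<open>log m + O(1)\<close> further coordinates, so that only consecutive layers are adjacent.
\<close>

section \<open>Cube vertices as sets of coordinates, edges as single flips\<close>

definition toggle :: "'a \<Rightarrow> 'a set \<Rightarrow> 'a set" where
  "toggle i V = sym_diff V {i}"

lemma mem_toggle [simp]: "j \<in> toggle i V \<longleftrightarrow> (j \<in> V) \<noteq> (j = i)"
  by (auto simp: toggle_def)

lemma toggle_toggle [simp]: "toggle i (toggle i V) = V"
  by auto

lemma toggle_neq [simp]: "toggle i V \<noteq> V" "V \<noteq> toggle i V"
  by (auto simp: set_eq_iff)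

lemma toggle_inject: "toggle i V = toggle j V \<longleftrightarrow> i = j"
  by (auto simp: set_eq_iff)

lemma toggle_commute: "toggle i (toggle j V) = toggle j (toggle i V)"
  by auto

lemma odd_card_toggle:
  assumes "finite V"
  shows "odd (card (toggle i V)) \<longleftrightarrow> even (card V)"
proof (cases "i \<in> V")
  case True
  then have "toggle i V = V - {i}" by auto
  moreover have "card V = Suc (card (V - {i}))"
    using card_Suc_Diff1[OF assms True] by simp
  ultimately show ?thesis by simp
next
  case False
  then have "toggle i V = insert i V" by auto
  then show ?thesis using False assms by simp
qed

section \<open>Long induced paths in the hypercube\<close>

text \<open>Reflected code: run through the code for \<open>m\<close>, then add \<open>m\<close> and
  run through it backwards; at the turn only \<open>m\<close> changes.\<close>

lemma gray_code:
  "\<exists>y :: nat \<Rightarrow> nat set. inj_on y {..<2 ^ m} \<and> (\<forall>t<2 ^ m. y t \<subseteq> {..<m}) \<and>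
     (\<forall>t. Suc t < 2 ^ m \<longrightarrow> (\<exists>d<m. y (Suc t) = toggle d (y t)))"
proof (induction m)
  case 0
  show ?case by (rule exI[of _ "\<lambda>_. {}"]) (auto simp: inj_on_def)
next
  case (Suc m)
  then obtain y :: "nat \<Rightarrow> nat set" where inj: "inj_on y {..<2 ^ m}"
    and sub: "\<And>t. t < 2 ^ m \<Longrightarrow> y t \<subseteq> {..<m}"
    and step: "\<And>t. Suc t < 2 ^ m \<Longrightarrow> \<exists>d<m. y (Suc t) = toggle d (y t)"
    by blast
  define z where "z t = (if t < 2 ^ m then y t else insert m (y (2 ^ Suc m - 1 - t)))" for t
  have notin: "m \<notin> y t" if "t < 2 ^ m" for t using sub[OF that] by auto
  have "inj_on z {..<2 ^ Suc m}"
  proof (rule inj_onI)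
    fix t t' :: nat
    assume t: "t \<in> {..<2 ^ Suc m}" "t' \<in> {..<2 ^ Suc m}" and eq: "z t = z t'"
    have r: "2 ^ Suc m - 1 - t < 2 ^ m" if "\<not> t < 2 ^ m" "t < 2 ^ Suc m" for t :: nat
      using that by auto
    have mz: "m \<in> z t \<longleftrightarrow> \<not> t < 2 ^ m" if "t < 2 ^ Suc m" for t
      using notin that by (auto simp: z_def)
    show "t = t'"
    proof (cases "t < 2 ^ m")
      case True
      then have "t' < 2 ^ m" using mz[of t] mz[of t'] t eq by auto
      then show ?thesis using True eq inj by (auto simp: z_def inj_on_def)
    next
      case False
      then have F': "\<not> t' < 2 ^ m" using mz[of t] mz[of t'] t eq by auto
      have rt: "2 ^ Suc m - 1 - t < 2 ^ m" "2 ^ Suc m - 1 - t' < 2 ^ m"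
        using r False F' t by auto
      have "insert m (y (2 ^ Suc m - 1 - t)) = insert m (y (2 ^ Suc m - 1 - t'))"
        using eq False F' by (simp add: z_def)
      then have "y (2 ^ Suc m - 1 - t) = y (2 ^ Suc m - 1 - t')"
        using notin rt by (meson insert_ident)
      then have "2 ^ Suc m - 1 - t = 2 ^ Suc m - 1 - t'"
        using inj rt by (auto simp: inj_on_def)
      then show ?thesis using t by auto
    qed
  qed
  moreover have "z t \<subseteq> {..<Suc m}" if t: "t < 2 ^ Suc m" for t
  proof (cases "t < 2 ^ m")
    case True
    then show ?thesis using sub[of t] by (auto simp: z_def)
  next
    case False
    then have "2 ^ Suc m - 1 - t < 2 ^ m" using t by auto
    then show ?thesis using sub[of "2 ^ Suc m - 1 - t"] False by (auto simp: z_def)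
  qed
  moreover have "\<exists>d<Suc m. z (Suc t) = toggle d (z t)" if t: "Suc t < 2 ^ Suc m" for t
  proof -
    consider "Suc t < 2 ^ m" | "Suc t = 2 ^ m" | "2 ^ m \<le> t" by linarith
    then show ?thesis
    proof cases
      case 1
      then show ?thesis using step[OF 1] by (auto simp: z_def intro: less_SucI)
    next
      case 2
      then have "2 ^ Suc m - 1 - Suc t = t" by simp
      then have "z (Suc t) = insert m (y t)" "z t = y t" using 2 by (auto simp: z_def)
      moreover have "m \<notin> y t" using notin[of t] 2 by simp
      ultimately have "z (Suc t) = toggle m (z t)" by auto
      then show ?thesis by blast
    next
      case 3
      define w where "w = 2 ^ Suc m - 1 - Suc t"
      have w: "2 ^ Suc m - 1 - t = Suc w" "Suc w < 2 ^ m" using t 3 by (auto simp: w_def)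
      obtain d where d: "d < m" "y (Suc w) = toggle d (y w)" using step[OF w(2)] by blast
      have "z (Suc t) = insert m (y w)" "z t = insert m (y (Suc w))"
        using 3 w by (auto simp: z_def w_def)
      then have "z (Suc t) = toggle d (z t)" using d by auto
      then show ?thesis using d by (auto intro: less_SucI)
    qed
  qed
  ultimately show ?case by blast
qed

text \<open>A shortest path has no chords, and it has to pass through all intermediate levels of \<open>f\<close>.\<close>

lemma induced_path_exists:
  fixes R :: "'a rel" and f :: "'a \<Rightarrow> nat"
  assumes conn: "(a, b) \<in> R\<^sup>*" and lip: "\<And>x y. (x, y) \<in> R \<Longrightarrow> f y \<le> Suc (f x)"
    and f: "f b = f a + N"
  obtains p where "\<And>k. k < N \<Longrightarrow> (p k, p (Suc k)) \<in> R"
    "\<And>k l. \<lbrakk>Suc k < l; l \<le> N\<rbrakk> \<Longrightarrow> (p k, p l) \<notin> R \<and> p k \<noteq> p l"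
proof -
  define L where "L = (LEAST L. (a, b) \<in> R ^^ L)"
  have L: "(a, b) \<in> R ^^ L" unfolding L_def
    using conn rtrancl_imp_relpow by (metis LeastI_ex)
  have least: "L \<le> l" if "(a, b) \<in> R ^^ l" for l
    unfolding L_def using that by (rule Least_le)
  obtain p where p: "p 0 = a" "p L = b" "\<And>i. i < L \<Longrightarrow> (p i, p (Suc i)) \<in> R"
    using L by (auto simp: relpow_fun_conv)
  have "f (p k) \<le> f a + k" if "k \<le> L" for k
    using that
  proof (induction k)
    case (Suc k)
    then show ?case using lip[OF p(3), of k] by simp
  qed (simp add: p)
  \<comment> \<open>\<open>f\<close> rises by at most one per edge, so the shortest path has at
    least \<open>N\<close> edges; only its first \<open>N\<close> are kept.\<close>
  from this[of L] have NL: "N \<le> L" using p f by simp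
  have pre: "(a, p k) \<in> R ^^ k" if "k \<le> L" for k
    unfolding relpow_fun_conv using p that by (intro exI[of _ p]) auto
  have post: "(p l, b) \<in> R ^^ (L - l)" if "l \<le> L" for l
    unfolding relpow_fun_conv using p that by (intro exI[of _ "\<lambda>i. p (l + i)"]) auto
  have "(p k, p l) \<notin> R \<and> p k \<noteq> p l" if "Suc k < l" "l \<le> N" for k l
  proof (intro conjI notI)
    have le: "k \<le> L" "l \<le> L" using that NL by auto
    show False if "(p k, p l) \<in> R"
    proof -
      have "(a, p l) \<in> R ^^ Suc k" using pre[OF le(1)] that by auto
      then have "(a, b) \<in> R ^^ (Suc k + (L - l))"
        using post[OF le(2)] by (auto simp only: relpow_add)
      from least[OF this] show False using \<open>Suc k < l\<close> le by simp
    qed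
    show False if "p k = p l"
    proof -
      have "(a, b) \<in> R ^^ (k + (L - l))"
        using post[OF le(2)] pre[OF le(1)] that by (auto simp only: relpow_add)
      from least[OF this] show False using \<open>Suc k < l\<close> le by simp
    qed
  qed
  then show ?thesis using p(3) NL by (intro that[of p]) auto
qed

section \<open>The Gray code thickened by labels\<close>

text \<open>Consecutive vertices are adjacent, hence distinct; repetitions and chords are excluded
  for pairs at least two steps apart.\<close>

definition induced_cube_path :: "nat \<Rightarrow> nat \<Rightarrow> (nat \<Rightarrow> nat set) \<Rightarrow> (nat \<Rightarrow> nat) \<Rightarrow> bool" where
  "induced_cube_path n N v d \<longleftrightarrow>
     (\<forall>k\<le>N. v k \<subseteq> {..<n}) \<and>
     (\<forall>k<N. d k < n \<and> v (Suc k) = toggle (d k) (v k)) \<and>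
     (\<forall>k l. Suc k < l \<and> l \<le> N \<longrightarrow> v l \<noteq> v k \<and> (\<forall>i<n. v l \<noteq> toggle i (v k)))"

text \<open>The sum over GF(2) of the columns \<open>h i\<close> for \<open>i \<in> Y\<close>, as in
  a parity check. If the columns are distinct, any two neighbours of a finite set have different
  syndromes.\<close>

definition syndrome :: "(nat \<Rightarrow> nat set) \<Rightarrow> nat set \<Rightarrow> nat set" where
  "syndrome h Y = {j. odd (card {i \<in> Y. j \<in> h i})}"

lemma syndrome_toggle:
  assumes "finite Y"
  shows "syndrome h (toggle d Y) = sym_diff (syndrome h Y) (h d)"
proof -
  have "{i \<in> toggle d Y. j \<in> h i} =
      (if j \<in> h d then toggle d {i \<in> Y. j \<in> h i} else {i \<in> Y. j \<in> h i})" for j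
    by auto
  then show ?thesis
    using assms by (auto simp: syndrome_def odd_card_toggle)
qed

lemma syndrome_subset:
  assumes "Y \<subseteq> {..<m}" "\<And>i. i < m \<Longrightarrow> h i \<subseteq> {..<q}"
  shows "syndrome h Y \<subseteq> {..<q}"
proof
  fix j assume j: "j \<in> syndrome h Y"
  then have "card {i \<in> Y. j \<in> h i} \<noteq> 0"
    by (auto simp: syndrome_def intro: Nat.gr0I)
  then have "{i \<in> Y. j \<in> h i} \<noteq> {}"
    by (metis card.empty)
  then obtain i where "i \<in> Y" "j \<in> h i" by auto
  with assms show "j \<in> {..<q}" by (meson in_mono lessThan_iff)
qed

text \<open>Layout of the \<open>m + q + 2\<close> coordinates: code word, label, two control
  bits.\<close>

definition vert :: "nat \<Rightarrow> nat \<Rightarrow> nat set \<Rightarrow> nat set \<Rightarrow> bool \<Rightarrow> bool \<Rightarrow> nat set" where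
  "vert m q Y l a b =
     {x. x \<in> Y \<or> m \<le> x \<and> x - m \<in> l \<or> x = m + q \<and> a \<or> x = m + q + 1 \<and> b}"

lemma toggle_vert:
  assumes "Y \<subseteq> {..<m}" "l \<subseteq> {..<q}"
  shows "d < m \<Longrightarrow> toggle d (vert m q Y l a b) = vert m q (toggle d Y) l a b"
    and "j < q \<Longrightarrow> toggle (m + j) (vert m q Y l a b) = vert m q Y (toggle j l) a b"
    and "toggle (m + q) (vert m q Y l a b) = vert m q Y l (\<not> a) b"
    and "toggle (m + q + 1) (vert m q Y l a b) = vert m q Y l a (\<not> b)"
proof -
  have Y: "x \<in> Y \<Longrightarrow> x < m" and l: "x \<in> l \<Longrightarrow> x < q" for x
    using assms by auto
  show "toggle d (vert m q Y l a b) = vert m q (toggle d Y) l a b" if "d < m"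
    using that by (intro set_eqI) (auto simp: vert_def)
  show "toggle (m + j) (vert m q Y l a b) = vert m q Y (toggle j l) a b" if "j < q"
    using that Y by (intro set_eqI) (force simp: vert_def)
  show "toggle (m + q) (vert m q Y l a b) = vert m q Y l (\<not> a) b"
    using Y[of "m + q"] l[of q] by (intro set_eqI) (auto simp: vert_def)
  show "toggle (m + q + 1) (vert m q Y l a b) = vert m q Y l a (\<not> b)"
    using Y[of "m + q + 1"] l[of "q + 1"] by (intro set_eqI) (auto simp: vert_def)
qed

lemma vert_decode:
  assumes "Y \<subseteq> {..<m}" "l \<subseteq> {..<q}"
  shows "vert m q Y l a b \<inter> {..<m} = Y"
    and "{j. j < q \<and> m + j \<in> vert m q Y l a b} = l"
    and "m + q \<in> vert m q Y l a b \<longleftrightarrow> a"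
    and "Suc (m + q) \<in> vert m q Y l a b \<longleftrightarrow> b"
    and "vert m q Y l a b \<subseteq> {..<m + q + 2}"
  using assms by (auto simp: vert_def)

text \<open>
  The path moves through the layers \<open>Y = y 0, y 1, \<dots>\<close> of a Gray code. Layer \<open>y t\<close> is entered with
  the label \<open>syndrome h (y (t - 1))\<close> and both bits equal to the parity of \<open>y (t - 1)\<close>; then \<open>a\<close> is
  switched, the label is changed to \<open>syndrome h (y t)\<close>, and \<open>b\<close> is switched. Neighbouring layers
  have opposite parities and so can only share a vertex with \<open>a = b\<close>; the syndromes then show
  that they are consecutive.
\<close>

lemma long_induced_path:
  assumes m: "m \<le> 2 ^ q"
  shows "\<exists>v d. induced_cube_path (m + q + 2) (2 ^ m - 1) v d"
proof -
  obtain y :: "nat \<Rightarrow> nat set" where inj: "inj_on y {..<2 ^ m}"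
    and sub: "\<And>t. t < 2 ^ m \<Longrightarrow> y t \<subseteq> {..<m}"
    and step: "\<And>t. Suc t < 2 ^ m \<Longrightarrow> \<exists>d<m. y (Suc t) = toggle d (y t)"
    using gray_code[of m] by blast
  \<comment> \<open>\<open>m \<le> 2 ^ q\<close> leaves enough subsets of \<open>{..<q}\<close> for
    the \<open>m\<close> columns to be distinct.\<close>
  have "card {..<m} \<le> card (Pow {..<q})" using m by (simp add: card_Pow)
  then obtain h :: "nat \<Rightarrow> nat set" where h: "h ` {..<m} \<subseteq> Pow {..<q}" "inj_on h {..<m}"
    by (metis card_le_inj finite_Pow_iff finite_lessThan)
  have hq: "h i \<subseteq> {..<q}" if "i < m" for i using h(1) that by blast
  define s where "s t = syndrome h (y t)" for t
  define e where "e t = odd (card (y t))" for t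
  have fin: "finite (y t)" if "t < 2 ^ m" for t using sub[OF that] finite_subset by blast
  have s_sub: "s t \<subseteq> {..<q}" if "t < 2 ^ m" for t
    unfolding s_def by (rule syndrome_subset[OF sub[OF that] hq])
  have e_step: "e t' \<longleftrightarrow> \<not> e t" if "y t' = toggle d (y t)" "t < 2 ^ m" for t t' d
    using that odd_card_toggle[OF fin] by (simp add: e_def)
  have e_Suc: "e (Suc t) \<longleftrightarrow> \<not> e t" if "Suc t < 2 ^ m" for t
    using step[OF that] e_step that by (meson Suc_lessD)
  \<comment> \<open>The last disjunct is the entry vertex. Once \<open>a\<close> has its new value,
    the label is free while \<open>b\<close> lags behind and must be \<open>s t\<close> when
    \<open>b\<close> has caught up.\<close>
  define ok where "ok t l a b \<longleftrightarrow>
      a = e t \<and> (a \<noteq> b \<or> l = s t) \<or> (\<exists>t'. t = Suc t' \<and> a \<noteq> e t \<and> b = a \<and> l = s t')" for t l a b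
  define U where "U = {V. V \<subseteq> {..<m + q + 2} \<and> (\<exists>t<2 ^ m. V \<inter> {..<m} = y t \<and>
      ok t {j. j < q \<and> m + j \<in> V} (m + q \<in> V) (Suc (m + q) \<in> V))}"
  \<comment> \<open>All cube edges inside \<open>U\<close>: two vertices of \<open>U\<close> not
    related by \<open>R\<close> are not adjacent in the cube.\<close>
  define R where "R = {(V, W). V \<in> U \<and> W \<in> U \<and> (\<exists>d<m + q + 2. W = toggle d V)}"
  define f where "f V = the_inv_into {..<2 ^ m} y (V \<inter> {..<m})" for V
  have f_eq: "f V = t" if "V \<inter> {..<m} = y t" "t < 2 ^ m" for V t
    unfolding f_def using that inj by (simp add: the_inv_into_f_f)
  have U_I: "vert m q (y t) l a b \<in> U" if "t < 2 ^ m" "l \<subseteq> {..<q}" "ok t l a b" for t l a b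
    using that by (auto simp: U_def vert_decode[OF sub[OF that(1)] that(2), simplified])
  have shared: "t' = Suc t \<or> t = Suc t'"
    if t: "t < 2 ^ m" "t' < 2 ^ m" and ok: "ok t l a b" "ok t' l a b"
      and d: "y t' = toggle d (y t)" "d < m" for t t' l a b d
  proof -
    have key: "t' = Suc t"
      if t: "t < 2 ^ m" "t' < 2 ^ m" and ok: "ok t l a b" "ok t' l a b"
        and d: "y t' = toggle d (y t)" "d < m" and a: "a = e t" for t t' d
    proof -
      \<comment> \<open>Opposite parities: the shared vertex can only be the entry vertex of layer
        \<open>t'\<close>.\<close>
      have "a \<noteq> e t'" using e_step[OF d(1) t(1)] a by simp
      then obtain r where r: "t' = Suc r" "b = a" "l = s r" using ok(2) by (auto simp: ok_def)
      have "l = s t" using ok(1) a r \<open>b = a\<close> by (auto simp: ok_def)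
      obtain d' where d': "d' < m" "y t' = toggle d' (y r)" using step[of r] r t by auto
      have yt: "y t = toggle d (y t')" using d by simp
      have yr: "y r = toggle d' (y t')" using d' by simp
      \<comment> \<open>\<open>y t\<close> and \<open>y r\<close> are neighbours of
        \<open>y t'\<close> with the same syndrome \<open>l\<close>, so the coordinates flipped have
        equal columns and coincide.\<close>
      have "sym_diff (syndrome h (y t')) (h d) = sym_diff (syndrome h (y t')) (h d')"
        using \<open>l = s t\<close> \<open>l = s r\<close> syndrome_toggle[OF fin[OF t(2)]] by (simp add: s_def yt yr)
      then have "h d = h d'" by blast
      then have "d = d'" using h(2) d d' by (auto simp: inj_on_def)
      then have "y t = y r" using yt yr by simp
      then have "t = r" using inj t r by (auto simp: inj_on_def)
      then show ?thesis using r by simp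
    qed
    show ?thesis
    proof (cases "a = e t")
      case True
      then show ?thesis using key[OF t ok d] by simp
    next
      case False
      then have "a = e t'" using e_step[OF d(1) t(1)] by simp
      then show ?thesis using key[OF t(2,1) ok(2,1) _ d(2)] d(1) by simp
    qed
  qed
  have lip: "f W \<le> Suc (f V)" if VW: "(V, W) \<in> R" for V W
  proof -
    from VW obtain t t' d where V: "t < 2 ^ m" "V \<inter> {..<m} = y t"
        "ok t {j. j < q \<and> m + j \<in> V} (m + q \<in> V) (Suc (m + q) \<in> V)"
      and W: "t' < 2 ^ m" "W \<inter> {..<m} = y t'"
        "ok t' {j. j < q \<and> m + j \<in> W} (m + q \<in> W) (Suc (m + q) \<in> W)"
      and d: "W = toggle d V"
      by (auto simp: R_def U_def)
    show ?thesis
    proof (cases "d < m")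
      case True
      have "{j. j < q \<and> m + j \<in> W} = {j. j < q \<and> m + j \<in> V}"
        "m + q \<in> W \<longleftrightarrow> m + q \<in> V" "Suc (m + q) \<in> W \<longleftrightarrow> Suc (m + q) \<in> V"
        using True d by auto
      moreover have "y t' = toggle d (y t)"
        using True unfolding V(2)[symmetric] W(2)[symmetric] d by auto
      ultimately have "t' = Suc t \<or> t = Suc t'"
        using shared[OF V(1) W(1) V(3)] W(3) True by simp
      then show ?thesis using f_eq[OF V(2,1)] f_eq[OF W(2,1)] by auto
    next
      case False
      then have "W \<inter> {..<m} = V \<inter> {..<m}" using d by auto
      then show ?thesis by (simp add: f_def)
    qed
  qed
  have RI: "(V, toggle d V) \<in> R" if "V \<in> U" "toggle d V \<in> U" "d < m + q + 2" for V d
    using that by (auto simp: R_def)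
  \<comment> \<open>The vertex from which layer \<open>t\<close> is left: label and both bits are up
    to date.\<close>
  define w where "w t = vert m q (y t) (s t) (e t) (e t)" for t
  have w_step: "(w t, w (Suc t)) \<in> R\<^sup>*" if t: "Suc t < 2 ^ m" for t
  proof -
    note [simp] = sub[OF t] s_sub[OF t] sub[OF Suc_lessD[OF t]] s_sub[OF Suc_lessD[OF t]]
    obtain d where d: "d < m" "y (Suc t) = toggle d (y t)" using step[OF t] by blast
    have wU: "w t \<in> U" unfolding w_def using t by (intro U_I) (auto simp: ok_def)
    define w1 where "w1 = vert m q (y (Suc t)) (s t) (e t) (e t)"
    have w1U: "w1 \<in> U" unfolding w1_def using t e_Suc[OF t] by (intro U_I) (auto simp: ok_def)
    have "w1 = toggle d (w t)" unfolding w1_def w_def using d by (simp add: toggle_vert)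
    then have 1: "(w t, w1) \<in> R" using RI[OF wU] w1U d by simp
    define w2 where "w2 l = vert m q (y (Suc t)) l (\<not> e t) (e t)" for l
    have w2U: "w2 l \<in> U" if "l \<subseteq> {..<q}" for l
      unfolding w2_def using t that e_Suc[OF t] by (intro U_I) (auto simp: ok_def)
    have "w2 (s t) = toggle (m + q) w1" unfolding w1_def w2_def by (simp add: toggle_vert)
    then have 2: "(w1, w2 (s t)) \<in> R" using RI[OF w1U, of "m + q"] w2U[of "s t"] by simp
    \<comment> \<open>The label is free while the bits differ, so it is changed one coordinate at a
      time.\<close>
    have 3: "(w2 (s t), w2 (sym_diff (s t) D)) \<in> R\<^sup>*" if "finite D" "D \<subseteq> {..<q}" for D
      using that
    proof (induction D)
      case empty
      then show ?case by simp
    next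
      case (insert x D)
      let ?l = "sym_diff (s t) D"
      have l: "?l \<subseteq> {..<q}" using insert.prems s_sub[OF Suc_lessD[OF t]] by blast
      have "sym_diff (s t) (insert x D) = toggle x ?l" using insert.hyps by auto
      moreover have tl: "toggle x ?l \<subseteq> {..<q}" using l insert.prems by auto
      moreover have "w2 (toggle x ?l) = toggle (m + x) (w2 ?l)"
        unfolding w2_def using insert.prems l by (simp add: toggle_vert)
      ultimately have "(w2 ?l, w2 (sym_diff (s t) (insert x D))) \<in> R"
        using RI[OF w2U[OF l], of "m + x"] w2U[OF tl] insert.prems by simp
      then show ?case using insert by (meson insert_subset rtrancl.rtrancl_into_rtrancl)
    qed
    have "sym_diff (s t) (sym_diff (s t) (s (Suc t))) = s (Suc t)" by blast
    moreover have "sym_diff (s t) (s (Suc t)) \<subseteq> {..<q}"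
      using s_sub[OF Suc_lessD[OF t]] s_sub[OF t] by blast
    ultimately have 4: "(w2 (s t), w2 (s (Suc t))) \<in> R\<^sup>*"
      using 3 finite_subset finite_lessThan by metis
    have "w (Suc t) = toggle (m + q + 1) (w2 (s (Suc t)))"
      unfolding w_def w2_def using e_Suc[OF t] toggle_vert(4)[OF sub[OF t] s_sub[OF t]] by simp
    moreover have "w (Suc t) \<in> U" unfolding w_def using t by (intro U_I) (auto simp: ok_def)
    ultimately have 5: "(w2 (s (Suc t)), w (Suc t)) \<in> R"
      using RI[OF w2U[of "s (Suc t)"], of "m + q + 1"] by simp
    show ?thesis using 1 2 4 5 by (meson rtrancl.simps rtrancl_trans r_into_rtrancl)
  qed
  have conn: "(w 0, w t) \<in> R\<^sup>*" if "t < 2 ^ m" for t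
    using that by (induction t) (use w_step in \<open>auto intro: rtrancl_trans\<close>)
  have fw: "f (w t) = t" if "t < 2 ^ m" for t
    using that by (intro f_eq) (auto simp: w_def vert_decode sub s_sub)
  define N where "N = (2::nat) ^ m - 1"
  have N: "N < 2 ^ m" "f (w N) = f (w 0) + N" using fw[of N] fw[of 0] by (auto simp: N_def)
  obtain p where p: "\<And>k. k < N \<Longrightarrow> (p k, p (Suc k)) \<in> R"
    "\<And>k l. \<lbrakk>Suc k < l; l \<le> N\<rbrakk> \<Longrightarrow> (p k, p l) \<notin> R \<and> p k \<noteq> p l"
    using induced_path_exists[OF conn[OF N(1)] lip N(2)] by blast
  \<comment> \<open>For \<open>N = 0\<close> no edge places \<open>p 0\<close> in \<open>U\<close>;
    the constant \<open>{}\<close> serves as the one-vertex path.\<close>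
  define v where "v = (if N = 0 then (\<lambda>_. {}) else p)"
  have vU: "p k \<in> U" if "k \<le> N" "N \<noteq> 0" for k
    using p(1)[of k] p(1)[of "k - 1"] that by (cases "k = N") (auto simp: R_def)
  have "\<exists>d<m + q + 2. p (Suc k) = toggle d (p k)" if "k < N" for k
    using p(1)[OF that] by (auto simp: R_def)
  then obtain d where d: "\<And>k. k < N \<Longrightarrow> d k < m + q + 2 \<and> p (Suc k) = toggle (d k) (p k)"
    by metis
  have "induced_cube_path (m + q + 2) N v d"
    unfolding induced_cube_path_def
  proof (intro conjI allI impI)
    show "v k \<subseteq> {..<m + q + 2}" if "k \<le> N" for k
      using vU[OF that] by (auto simp: v_def U_def)
    show "d k < m + q + 2" "v (Suc k) = toggle (d k) (v k)" if "k < N" for k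
      using d[OF that] that by (auto simp: v_def)
    fix k l assume kl: "Suc k < l \<and> l \<le> N"
    then have N0: "N \<noteq> 0" by auto
    show "v l \<noteq> v k" using p(2)[of k l] kl N0 by (auto simp: v_def)
    show "v l \<noteq> toggle i (v k)" if "i < m + q + 2" for i
      using p(2)[of k l] kl N0 that vU[of k] vU[of l] by (auto simp: v_def R_def)
  qed
  then show ?thesis by (auto simp: N_def)
qed

section \<open>Fictitious play along an induced path\<close>

text \<open>The bound on \<open>N\<close> keeps the largest payoff
  \<open>1 / 2 + N * \<delta>\<close> at most 1.\<close>

locale cube_path_game =
  fixes n N :: nat and v :: "nat \<Rightarrow> nat set" and d :: "nat \<Rightarrow> nat"
  assumes path: "induced_cube_path n N v d" and N_le: "4 * N \<le> 2 ^ n"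
begin

lemma v_sub: "k \<le> N \<Longrightarrow> v k \<subseteq> {..<n}"
  and d_less: "k < N \<Longrightarrow> d k < n"
  and v_Suc: "k < N \<Longrightarrow> v (Suc k) = toggle (d k) (v k)"
  and v_far: "\<lbrakk>Suc k < l; l \<le> N\<rbrakk> \<Longrightarrow> v l \<noteq> v k"
  and v_nonadj: "\<lbrakk>Suc k < l; l \<le> N; i < n\<rbrakk> \<Longrightarrow> v l \<noteq> toggle i (v k)"
  using path by (auto simp: induced_cube_path_def)

lemma v_inj: "\<lbrakk>v k = v l; k \<le> N; l \<le> N\<rbrakk> \<Longrightarrow> k = l"
proof (induction k l rule: linorder_wlog)
  case (le k l)
  show ?case
  proof (rule ccontr)
    assume "k \<noteq> l"
    then consider "l = Suc k" | "Suc k < l" using le by linarith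
    then show False
      using le v_Suc[of k] v_far[of k l] by cases auto
  qed
qed auto

section \<open>The common payoff and the incentives along the path\<close>

text \<open>Twice the tolerance \<open>1 / 2 ^ n\<close>, so that one step along the path is a
  forbidden gain.\<close>

definition \<delta> :: real where "\<delta> = 2 / 2 ^ n"

lemma delta_pos: "\<delta> > 0"
  by (simp add: \<delta>_def)

definition pot :: "nat set \<Rightarrow> real" where
  "pot V = (if \<exists>k\<le>N. V = v k then 1 / 2 + real (THE k. k \<le> N \<and> V = v k) * \<delta> else 0)"

lemma pot_v: "k \<le> N \<Longrightarrow> pot (v k) = 1 / 2 + real k * \<delta>"
proof -
  assume k: "k \<le> N"
  then have "(THE k'. k' \<le> N \<and> v k = v k') = k"
    by (intro the_equality) (use v_inj in auto)
  then show ?thesis using k by (auto simp: pot_def)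
qed

lemma pot_off: "(\<And>k. k \<le> N \<Longrightarrow> V \<noteq> v k) \<Longrightarrow> pot V = 0"
  by (auto simp: pot_def)

lemma pot_range: "pot V \<in> {0..1}"
proof (cases "\<exists>k\<le>N. V = v k")
  case True
  then obtain k where k: "k \<le> N" "V = v k" by blast
  have "4 * real k \<le> 2 ^ n" using N_le k
    by (metis (mono_tags, lifting) le_trans mult_le_mono2 of_nat_le_iff of_nat_mult of_nat_numeral of_nat_power)
  then have "real k * \<delta> \<le> 1 / 2" by (simp add: \<delta>_def field_simps)
  then show ?thesis using k pot_v[OF k(1)] delta_pos by simp
next
  case False
  then have "pot V = 0" by (intro pot_off) auto
  then show ?thesis by simp
qed

text \<open>The loss of player \<open>i\<close> from switching; negative if switching pays.\<close>

definition gap :: "nat \<Rightarrow> nat set \<Rightarrow> real" where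
  "gap i V = pot V - pot (toggle i V)"

lemma gap_next: "k < N \<Longrightarrow> gap (d k) (v k) = - \<delta>"
  using pot_v[of k] pot_v[of "Suc k"] v_Suc[of k] by (simp add: gap_def algebra_simps)

text \<open>The path is induced, so the only path vertices next to \<open>v k\<close> are its
  predecessor and successor; any other switch leads to payoff 0.\<close>

lemma gap_other:
  assumes k: "k < N" and i: "i < n" "i \<noteq> d k"
  shows "gap i (v k) \<ge> 1 / 2 \<or> k > 0 \<and> i = d (k - 1) \<and> gap i (v k) = \<delta>"
proof (cases "\<exists>l\<le>N. toggle i (v k) = v l")
  case False
  then have "pot (toggle i (v k)) = 0" by (intro pot_off) auto
  then show ?thesis using pot_v[of k] k delta_pos by (simp add: gap_def)
next
  case True
  then obtain l where l: "l \<le> N" "toggle i (v k) = v l" by blast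
  have ki: "v k = toggle i (v l)" using l(2) by (metis toggle_toggle)
  consider "l = k" | "l = Suc k" | "k = Suc l" | "Suc k < l" | "Suc l < k" by linarith
  then show ?thesis
  proof cases
    case 1
    then show ?thesis using l by simp
  next
    case 2
    then show ?thesis using l v_Suc[OF k] i toggle_inject by metis
  next
    case 3
    have "v k = toggle (d l) (v l)" using v_Suc[of l] 3 k by simp
    then have "i = d l" using ki toggle_inject by metis
    moreover have "gap i (v k) = \<delta>"
      using pot_v[of k] pot_v[of l] l k 3 by (simp add: gap_def algebra_simps)
    ultimately show ?thesis using 3 by simp
  next
    case 4
    then show ?thesis using v_nonadj[of k l i] l i by simp
  next
    case 5
    then show ?thesis using v_nonadj[of l k i] ki k i by simp
  qed
qed

lemma gap_other_pos: "\<lbrakk>k < N; i < n; i \<noteq> d k\<rbrakk> \<Longrightarrow> gap i (v k) > 0"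
  using gap_other[of k i] delta_pos by auto

text \<open>Flipping the same coordinate twice would return to \<open>v k\<close>.\<close>

lemma d_Suc: "Suc k < N \<Longrightarrow> d (Suc k) \<noteq> d k"
  using v_Suc[of k] v_Suc[of "Suc k"] v_far[of k "Suc (Suc k)"] by auto

text \<open>If the player moving after stage \<open>Suc k\<close> were the one that moved into
  \<open>v k\<close>, its two flips would cancel and \<open>v (k + 2)\<close> would be adjacent to
  \<open>v (k - 1)\<close>, a chord.\<close>

lemma gap_two_ahead:
  assumes k: "Suc k < N"
  shows "gap (d (Suc k)) (v k) \<ge> 1 / 2"
proof -
  have "\<not> (k > 0 \<and> d (Suc k) = d (k - 1))"
  proof
    assume a: "k > 0 \<and> d (Suc k) = d (k - 1)"
    then obtain l where l: "k = Suc l" by (cases k) auto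
    have "v (Suc k) = toggle (d k) (toggle (d l) (v l))" "v (Suc (Suc k)) = toggle (d l) (v (Suc k))"
      using v_Suc[of l] v_Suc[of k] v_Suc[of "Suc k"] k l a by auto
    then have "v (Suc (Suc k)) = toggle (d k) (v l)"
      using toggle_commute toggle_toggle by metis
    then show False using v_nonadj[of l "Suc (Suc k)" "d k"] k l d_less[of k] by simp
  qed
  then show ?thesis using gap_other[of k "d (Suc k)"] d_Suc[OF k] d_less[of "Suc k"] k by auto
qed

section \<open>Accumulated incentives and the length of the stages\<close>

text \<open>Its sign decides the next action of player \<open>i\<close>, with a tie at 0.\<close>

definition score :: "(nat \<Rightarrow> nat set) \<Rightarrow> nat \<Rightarrow> nat \<Rightarrow> real" where
  "score X i t = (\<Sum>\<tau>=1..t. pot (insert i (X \<tau>)) - pot (X \<tau> - {i}))"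

text \<open>Signed so that a positive value holds player \<open>i\<close> on its side of
  \<open>V\<close>.\<close>

definition attach :: "(nat \<Rightarrow> nat set) \<Rightarrow> nat \<Rightarrow> nat set \<Rightarrow> nat \<Rightarrow> real" where
  "attach X i V t = (if i \<in> V then score X i t else - score X i t)"

lemma attach_Suc:
  assumes "X (Suc t) = V"
  shows "attach X i V (Suc t) = attach X i V t + gap i V"
proof -
  have "toggle i V = (if i \<in> V then V - {i} else insert i V)" by auto
  moreover have "i \<in> V \<Longrightarrow> insert i V = V" "i \<notin> V \<Longrightarrow> V - {i} = V" by auto
  ultimately show ?thesis using assms by (auto simp: attach_def score_def gap_def)
qed

text \<open>With \<open>B = 2 ^ n / 4\<close>: in stage \<open>k\<close> each round weakens the hold
  on player \<open>d k\<close> by \<open>\<delta>\<close> and strengthens that on player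
  \<open>d (Suc k)\<close> by at least \<open>1 / 2\<close>. So a stage of at least
  \<open>B ^ k\<close> rounds forces at least \<open>B ^ Suc k\<close> rounds in the next. The sign
  conditions are weak and thus cover every tie-breaking rule.\<close>

lemma play_follows_path:
  fixes X :: "nat \<Rightarrow> nat set"
  assumes N: "N > 0" and start: "X 1 = v 0" and X_sub: "\<And>t. t \<ge> 1 \<Longrightarrow> X t \<subseteq> {..<n}"
    and up: "\<And>t i. \<lbrakk>t \<ge> 1; i < n; i \<in> X (Suc t)\<rbrakk> \<Longrightarrow> score X i t \<ge> 0"
    and down: "\<And>t i. \<lbrakk>t \<ge> 1; i < n; i \<notin> X (Suc t)\<rbrakk> \<Longrightarrow> score X i t \<le> 0"
    and t: "1 \<le> t" "real t \<le> (2 ^ n / 4) ^ (N - 1)"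
  shows "\<exists>k<N. X t = v k"
proof -
  \<comment> \<open>Number of rounds at \<open>\<delta>\<close> that undo one round at
    \<open>1 / 2\<close>.\<close>
  define B :: real where "B = 2 ^ n / 4"
  have ex2I: "\<exists>k c. P k c" if "P k c" for P :: "nat \<Rightarrow> nat \<Rightarrow> bool" and k c
    using that by blast
  have B: "\<delta> * B = 1 / 2" by (simp add: B_def \<delta>_def)
  \<comment> \<open>\<open>c\<close> counts the rounds of the current stage.\<close>
  have "\<exists>k c. k < N \<and> 1 \<le> c \<and> c \<le> t \<and> X t = v k \<and>
      (\<forall>i<n. i \<noteq> d k \<longrightarrow> attach X i (v k) t > 0) \<and>
      (Suc k < N \<longrightarrow> attach X (d (Suc k)) (v k) t \<ge> real c / 2) \<and>
      attach X (d k) (v k) t \<ge> \<delta> * ((if k = 0 then 0 else B ^ k) - real c)"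
    using t
  proof (induction t rule: nat_induct_at_least)
    case base
    \<comment> \<open>No earlier stage holds player \<open>d 0\<close>, hence 0 in place of
      \<open>B ^ 0\<close> in the invariant.\<close>
    have init: "attach X i (v 0) 1 = gap i (v 0)" for i
      using attach_Suc[of X 0 "v 0" i] start by (simp add: attach_def score_def)
    show ?case
      using N start gap_other_pos[of 0] gap_next[of 0] gap_two_ahead[of 0]
      by (intro ex2I[where k = 0 and c = 1]) (auto simp: init[simplified])
  next
    case (Suc t)
    then obtain k c where k: "k < N" and c: "1 \<le> c" "c \<le> t" and Xt: "X t = v k"
      and oth: "\<And>i. \<lbrakk>i < n; i \<noteq> d k\<rbrakk> \<Longrightarrow> attach X i (v k) t > 0"
      and nxt: "Suc k < N \<Longrightarrow> attach X (d (Suc k)) (v k) t \<ge> real c / 2"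
      and cur: "attach X (d k) (v k) t \<ge> \<delta> * ((if k = 0 then 0 else B ^ k) - real c)"
      by auto
    \<comment> \<open>A strictly positive hold decides the action without a tie, so only player
      \<open>d k\<close> can move.\<close>
    have keep: "i \<in> X (Suc t) \<longleftrightarrow> i \<in> v k" if "i < n" "i \<noteq> d k" for i
      using oth[OF that] up[of t i] down[of t i] Suc.hyps that by (auto simp: attach_def split: if_splits)
    have out: "i \<notin> X (Suc t)" "i \<notin> v k" if "\<not> i < n" for i
      using X_sub[of "Suc t"] v_sub[of k] that k by auto
    show ?case
    proof (cases "d k \<in> X (Suc t) \<longleftrightarrow> d k \<in> v k")
      case True
      then have X': "X (Suc t) = v k"
        using keep out by (metis subsetI subset_antisym)
      note att = attach_Suc[where X = X, OF X']
      have "attach X i (v k) (Suc t) > 0" if "i < n" "i \<noteq> d k" for i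
        using oth[OF that] gap_other_pos[OF k that] by (simp add: att)
      moreover have "attach X (d (Suc k)) (v k) (Suc t) \<ge> real (Suc c) / 2" if "Suc k < N"
        using nxt[OF that] gap_two_ahead[OF that] by (simp add: att)
      moreover have "attach X (d k) (v k) (Suc t) \<ge> \<delta> * ((if k = 0 then 0 else B ^ k) - real (Suc c))"
        using cur gap_next[OF k] by (simp add: att algebra_simps)
      ultimately show ?thesis using k c X'
        by (intro ex2I[where k = k and c = "Suc c"]) auto
    next
      case False
      \<comment> \<open>Player \<open>d k\<close> moves only when its hold is used up, hence after
        at least \<open>B ^ k\<close> rounds of the stage; for \<open>k = 0\<close> this is
        \<open>1 \<le> c\<close>.\<close>
      have "attach X (d k) (v k) t \<le> 0"
        using False up[of t "d k"] down[of t "d k"] d_less[OF k] Suc.hyps by (auto simp: attach_def)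
      then have "\<delta> * ((if k = 0 then 0 else B ^ k) - real c) \<le> 0" using cur by linarith
      then have "(if k = 0 then 0 else B ^ k) \<le> real c" using delta_pos by (simp add: mult_le_0_iff)
      then have cB: "B ^ k \<le> real c" using c by (cases "k = 0") auto
      \<comment> \<open>Leaving the last stage would need \<open>B ^ (N - 1)\<close> rounds before
        round \<open>Suc t\<close>, beyond the time bound.\<close>
      have k1: "Suc k < N"
      proof (rule ccontr)
        assume "\<not> Suc k < N"
        then have "k = N - 1" using k by simp
        then have "real (Suc t) \<le> real t" using cB c Suc.prems by (simp add: B_def)
        then show False by simp
      qed
      have X': "X (Suc t) = v (Suc k)"
      proof (rule set_eqI)
        fix i
        show "i \<in> X (Suc t) \<longleftrightarrow> i \<in> v (Suc k)"
          using keep[of i] out[of i] False v_Suc[OF k] d_less[OF k]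
          by (cases "i = d k"; cases "i < n") auto
      qed
      note att = attach_Suc[where X = X, OF X']
      have same: "attach X i (v (Suc k)) t = attach X i (v k) t" if "i \<noteq> d k" for i
        using that v_Suc[OF k] by (simp add: attach_def)
      have opp: "attach X (d k) (v (Suc k)) t = - attach X (d k) (v k) t"
        using v_Suc[OF k] by (simp add: attach_def)
      \<comment> \<open>The mover may just have been indifferent; the positive gap of the new round
        then makes its hold strict.\<close>
      have nonneg: "attach X i (v (Suc k)) t \<ge> 0" if "i < n" for i
        using same[of i] opp oth[OF that] \<open>attach X (d k) (v k) t \<le> 0\<close> by (cases "i = d k") auto
      have "attach X i (v (Suc k)) (Suc t) > 0" if "i < n" "i \<noteq> d (Suc k)" for i
        using nonneg[OF that(1)] gap_other_pos[OF k1 that] by (simp add: att)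
      moreover have "attach X (d (Suc (Suc k))) (v (Suc k)) (Suc t) \<ge> real 1 / 2" if "Suc (Suc k) < N"
        using nonneg[OF d_less[OF that]] gap_two_ahead[OF that] by (simp add: att)
      \<comment> \<open>The finished stage left a hold of at least \<open>c / 2\<close>, hence of
        \<open>\<delta> * B ^ Suc k\<close>; the first new round costs
        \<open>\<delta>\<close>.\<close>
      moreover have "attach X (d (Suc k)) (v (Suc k)) (Suc t) \<ge> \<delta> * (B ^ Suc k - real 1)"
      proof -
        have "\<delta> * B ^ Suc k = B ^ k / 2" using B by simp
        then have "\<delta> * B ^ Suc k \<le> attach X (d (Suc k)) (v k) t" using nxt[OF k1] cB by linarith
        then show ?thesis
          using same[OF d_Suc[OF k1]] gap_next[OF k1] by (simp add: att algebra_simps)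
      qed
      ultimately show ?thesis using k1 X'
        by (intro ex2I[where k = "Suc k" and c = 1]) auto
    qed
  qed
  then show ?thesis by blast
qed

section \<open>The game with identical interests\<close>

definition supp :: "(nat \<Rightarrow> bool) \<Rightarrow> nat set" where
  "supp x = {i. i < n \<and> x i}"

definition game :: "bool game" where
  "game i x = pot (supp x)"

definition start_profile :: "nat \<Rightarrow> bool" where
  "start_profile = (\<lambda>i\<in>{..<n}. i \<in> v 0)"

lemma supp_upd: "i < n \<Longrightarrow> supp (x(i := a)) = (if a then insert i (supp x) else supp x - {i})"
  by (auto simp: supp_def)

lemma supp_start_profile: "supp start_profile = v 0"
  using v_sub[of 0] by (auto simp: supp_def start_profile_def)

lemma game_range: "game i x \<in> {0..1}"
  using pot_range by (simp add: game_def)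

text \<open>The common expected utility is itself a potential, on mixed profiles too.\<close>

lemma potential_game_game: "potential_game n game"
proof -
  have "utility n game i = utility n game 0" for i
    by (simp add: utility_def game_def[abs_def] fun_eq_iff)
  then show ?thesis unfolding potential_game_def by metis
qed

text \<open>Player \<open>d k\<close> gains \<open>\<delta>\<close>, twice the tolerance, by moving
  on to \<open>v (Suc k)\<close>.\<close>

lemma not_nash:
  assumes x: "x \<in> profiles n" and k: "k < N" and s: "supp x = v k"
  shows "\<not> nash_equilibrium (1 / 2 ^ n) n game (pure_profile n x)"
proof
  assume nash: "nash_equilibrium (1 / 2 ^ n) n game (pure_profile n x)"
  define x' where "x' = x(d k := (\<not> x (d k)))"
  have dn: "d k < n" by (rule d_less[OF k])
  have x': "x' \<in> profiles n" using x dn by (auto simp: x'_def profiles_def PiE_def extensional_def)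
  have "(pure_profile n x)(d k := return_pmf (\<not> x (d k))) = pure_profile n x'"
    using dn by (auto simp: pure_profile_def x'_def fun_eq_iff)
  then have "utility n game (d k) (pure_profile n x') \<le> utility n game (d k) (pure_profile n x) + 1 / 2 ^ n"
    using nash dn unfolding nash_equilibrium_def by metis
  then have "pot (supp x') \<le> pot (supp x) + 1 / 2 ^ n"
    using utility_pure_profile[OF x] utility_pure_profile[OF x'] by (simp add: game_def)
  moreover have "supp x' = v (Suc k)"
    unfolding v_Suc[OF k] s[symmetric] using dn by (auto simp: x'_def supp_def)
  ultimately have "\<delta> \<le> 1 / 2 ^ n"
    using s pot_v[of k] pot_v[of "Suc k"] k by (simp add: algebra_simps)
  then show False by (simp add: \<delta>_def field_simps)
qed

lemma fictitious_play_not_nash: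
  assumes N: "N > 0" and fp: "fictitious_play n game start_profile x"
    and t: "1 \<le> t" "real t \<le> (2 ^ n / 4) ^ (N - 1)"
  shows "\<not> nash_equilibrium (1 / 2 ^ n) n game (pure_profile n (x t))"
proof -
  define X where "X t = supp (x t)" for t
  have prof: "\<And>t. t \<ge> 1 \<Longrightarrow> x t \<in> profiles n" and x1: "x 1 = start_profile"
    and am: "\<And>t i. \<lbrakk>t \<ge> 1; i < n\<rbrakk> \<Longrightarrow>
      is_arg_max (\<lambda>a. \<Sum>\<tau>=1..t. game i ((x \<tau>)(i := a))) (\<lambda>a. True) (x (t + 1) i)"
    using fp by (auto simp: fictitious_play_def)
  have score: "score X i t = (\<Sum>\<tau>=1..t. game i ((x \<tau>)(i := True))) -
      (\<Sum>\<tau>=1..t. game i ((x \<tau>)(i := False)))" if "i < n" for i t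
    using that by (simp add: score_def X_def game_def supp_upd sum_subtractf)
  \<comment> \<open>Comparing the chosen action with each alternative gives the weak sign conditions
    on \<open>score\<close>.\<close>
  have le: "(\<Sum>\<tau>=1..t. game i ((x \<tau>)(i := a))) \<le> (\<Sum>\<tau>=1..t. game i ((x \<tau>)(i := x (Suc t) i)))"
    if "t \<ge> 1" "i < n" for t i a
    using am[OF that] by (simp add: is_arg_max_linorder)
  have "\<exists>k<N. X t = v k"
  proof (rule play_follows_path[OF N _ _ _ _ t])
    show "X 1 = v 0" using x1 by (simp add: X_def supp_start_profile)
    show "X t \<subseteq> {..<n}" for t by (auto simp: X_def supp_def)
    show "score X i t \<ge> 0" if "t \<ge> 1" "i < n" "i \<in> X (Suc t)" for t i
      using le[OF that(1,2), of False] that(3) score[OF that(2)] by (simp add: X_def supp_def)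
    show "score X i t \<le> 0" if "t \<ge> 1" "i < n" "i \<notin> X (Suc t)" for t i
      using le[OF that(1,2), of True] that score[OF that(2)] by (simp add: X_def supp_def)
  qed
  then show ?thesis using not_nash[OF prof[OF t(1)]] by (auto simp: X_def)
qed

end

section \<open>Choice of parameters\<close>

text \<open>Take \<open>q\<close> as the logarithm of \<open>n\<close> rounded up: then
  \<open>2 ^ q < 2 * n\<close>, and the \<open>q + 2\<close> extra coordinates cost a factor of at
  most \<open>8 * n\<close>.\<close>

lemma dimension_split:
  assumes n: "n \<ge> (8::nat)"
  obtains m q where "n = m + q + 2" "m \<le> 2 ^ q" "2 \<le> m" "2 ^ n \<le> 8 * n * (2::nat) ^ m"
proof -
  \<comment> \<open>Bounding \<open>n\<close> instead of \<open>m\<close> avoids circularity, since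
    \<open>m\<close> is defined from \<open>q\<close>.\<close>
  define q where "q = (LEAST q. n \<le> 2 ^ q)"
  have q: "n \<le> 2 ^ q" unfolding q_def
    by (rule LeastI[of _ n]) (simp add: less_imp_le)
  then have "q \<noteq> 0" using n by (cases q) auto
  then have "\<not> n \<le> 2 ^ (q - 1)" unfolding q_def by (intro not_less_Least) simp
  then have q2: "2 ^ q < 2 * n" using \<open>q \<noteq> 0\<close> by (cases q) auto
  have "16 * n \<le> 2 ^ n"
    using n by (induction n rule: nat_induct_at_least) auto
  then have "2 * n \<le> 2 ^ (n - 3)" using n power_add[of "2::nat" 3 "n - 3"] by simp
  then have "(2::nat) ^ q < 2 ^ (n - 3)" using q2 by linarith
  then have "q < n - 3" by (simp add: power_strict_increasing_iff)
  define m where "m = n - q - 2"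
  have nm: "n = m + q + 2" "2 \<le> m" using \<open>q < n - 3\<close> by (auto simp: m_def)
  have "(2::nat) ^ n = 4 * 2 ^ q * 2 ^ m" by (simp add: nm(1) power_add)
  also have "\<dots> \<le> 4 * (2 * n) * 2 ^ m" using q2 by (intro mult_le_mono) auto
  finally show ?thesis using that[of m q] nm q by simp
qed

text \<open>The right-hand side is 2 to the power \<open>(n - 2) * (2 ^ m - 2)\<close>. Each factor
  is at least half of \<open>n\<close> and \<open>2 ^ m\<close> respectively, and
  \<open>n * 2 ^ m\<close> is at least \<open>2 ^ n / 8\<close>.\<close>

lemma stage_length_bound:
  assumes n: "n = m + q + 2" "n \<ge> 8" and m: "2 \<le> m" and le: "2 ^ n \<le> 8 * n * (2::nat) ^ m"
  shows "2 powr (1 / 32 * 2 ^ n) \<le> ((2::real) ^ n / 4) ^ (2 ^ m - 1 - 1)"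
proof -
  have base: "(2::real) ^ n / 4 = 2 ^ (n - 2)" using power_add[of "2::real" 2 "n - 2"] n by simp
  have m4: "(4::nat) \<le> 2 ^ m" using power_increasing[OF m, of "2::nat"] by simp
  have "n * 2 ^ m \<le> 4 * ((n - 2) * (2 ^ m - 1 - 1))"
  proof -
    have "n \<le> 2 * (n - 2)" "(2::nat) ^ m \<le> 2 * (2 ^ m - 1 - 1)" using n m4 by auto
    then have "n * 2 ^ m \<le> (2 * (n - 2)) * (2 * (2 ^ m - 1 - 1))" by (rule mult_le_mono)
    then show ?thesis by simp
  qed
  then have "2 ^ n \<le> 32 * ((n - 2) * (2 ^ m - 1 - 1))" using le by linarith
  then have "real (2 ^ n) \<le> real (32 * ((n - 2) * (2 ^ m - 1 - 1)))" by (rule of_nat_mono)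
  then have "1 / 32 * 2 ^ n \<le> real ((n - 2) * (2 ^ m - 1 - 1))" by simp
  then have "2 powr (1 / 32 * 2 ^ n) \<le> 2 powr real ((n - 2) * (2 ^ m - 1 - 1))" by simp
  also have "\<dots> = ((2::real) ^ n / 4) ^ (2 ^ m - 1 - 1)"
    by (simp only: base powr_realpow power_mult zero_less_numeral)
  finally show ?thesis .
qed

theorem theorem1p3:
  "\<exists>(c::real) (n\<^sub>0::nat). c > 0 \<and>
     (\<forall>n\<ge>n\<^sub>0. \<exists>(u :: bool game) (s :: nat \<Rightarrow> bool).
        potential_game n u \<and>
        (\<forall>i<n. \<forall>a\<in>profiles n. u i a \<in> {0..1}) \<and>
        s \<in> profiles n \<and>
        (\<forall>x. fictitious_play n u s x \<longrightarrow>
          (\<forall>t::nat. 1 \<le> t \<and> real t \<le> 2 powr (c * 2 ^ n) \<longrightarrow>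
             \<not> nash_equilibrium (1 / 2 ^ n) n u (pure_profile n (x t)))))"
\<comment> \<open>The threshold 8 comes from \<open>dimension_split\<close>; in 32, a factor 8 is
  due to the extra coordinates and 4 to the two halvings in
  \<open>stage_length_bound\<close>.\<close>
proof (rule exI[of _ "1 / 32"], rule exI[of _ 8], intro conjI allI impI)
  show "(0::real) < 1 / 32" by simp
  fix n :: nat
  assume n: "8 \<le> n"
  obtain m q where mq: "n = m + q + 2" "m \<le> 2 ^ q" "2 \<le> m" "2 ^ n \<le> 8 * n * (2::nat) ^ m"
    using dimension_split[OF n] by blast
  obtain v d where "induced_cube_path n (2 ^ m - 1) v d"
    using long_induced_path[OF mq(2)] mq(1) by auto
  moreover have "4 * (2 ^ m - 1) \<le> (2::nat) ^ n"
  proof -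
    have "4 * 2 ^ m \<le> (2::nat) ^ n"
      using power_increasing[of "m + 2" n "2::nat"] mq(1) by (simp add: power_add)
    then show ?thesis by linarith
  qed
  ultimately interpret cube_path_game n "2 ^ m - 1" v d by unfold_locales
  have "1 < (2::nat) ^ m" using mq(3) by (intro one_less_power) auto
  then have N: "0 < (2::nat) ^ m - 1" by simp
  have "start_profile \<in> profiles n"
    by (simp add: profiles_def start_profile_def)
  moreover have "\<not> nash_equilibrium (1 / 2 ^ n) n game (pure_profile n (x t))"
    if "fictitious_play n game start_profile x" "1 \<le> t" "real t \<le> 2 powr (1 / 32 * 2 ^ n)" for x t
    using fictitious_play_not_nash[OF N that(1,2)] that(3) stage_length_bound[OF mq(1) n mq(3,4)]
    by linarith
  ultimately show "\<exists>(u :: bool game) (s :: nat \<Rightarrow> bool).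
        potential_game n u \<and>
        (\<forall>i<n. \<forall>a\<in>profiles n. u i a \<in> {0..1}) \<and>
        s \<in> profiles n \<and>
        (\<forall>x. fictitious_play n u s x \<longrightarrow>
          (\<forall>t::nat. 1 \<le> t \<and> real t \<le> 2 powr (1 / 32 * 2 ^ n) \<longrightarrow>
             \<not> nash_equilibrium (1 / 2 ^ n) n u (pure_profile n (x t))))"
    using potential_game_game game_range
    by (intro exI[of _ game] exI[of _ start_profile]) blast
qed

end
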